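(* Let $\mathcal F$ be a function space on a finite partially ordered set $\mathfrak T$, and let $\mathcal F(\mathcal T)$ be the corresponding global function space. Assume that for every $F\in\mathfrak T$ we have chosen a subspace $\mathring{\mathcal F}(F)^\dagger$ of $\mathcal F(F)^*$ that is mapped isomorphically onto $\mathring{\mathcal F}(F)^*$ by restriction of functionals to $\mathring{\mathcal F}(F)$, and assume that we have local extension operators $E_F^{\mathcal T}\colon\mathring{\mathcal F}(F)\to\mathcal F(\mathcal T)$ for every $F\in\mathfrak T$. Then $\mathcal F(\mathcal T)^*$ is the (internal) direct sum $$\mathcal F(\mathcal T)^*=\bigoplus_{F\in\mathfrak T}\left(\operatorname{tr}^{\mathcal T}_F\right)^*\mathring{\mathcal F}(F)^\dagger.$$
   Context: All vector spaces are over a fixed field; $V^*$ is the space of linear functionals on $V$, and for a linear map $A\colon V\to W$ the dual map $A^*\colon W^*\to V^*$ is $A^*\alpha=\alpha\circ A$. A function space $\mathcal F$ on a partially ordered set $\mathfrak T$ consists of a vector space $\mathcal F(F)$ for every $F\in\mathfrak T$ and a linear map $\operatorname{tr}^F_K\colon\mathcal F(F)\to\mathcal F(K)$ (trace map) for every relation $K\le F$, such that $\operatorname{tr}^F_F$ is the identity and $\operatorname{tr}^G_K\circ\operatorname{tr}^F_G=\operatorname{tr}^F_K$ whenever $K\le G\le F$. The subspace of vanishing trace is $\mathring{\mathcal F}(F)=\{\phi\in\mathcal F(F)\mid\operatorname{tr}^F_K\phi=0\text{ for all }K<F\}$. The global function space is $$\mathcal F(\mathcal T)=\Big\{(\phi_F)_{F\in\mathfrak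 T}\in\prod_{F\in\mathfrak T}\mathcal F(F)\;\Big|\;\operatorname{tr}^F_K\phi_F=\phi_K\text{ for all }K\le F\Big\}$$ (here $\mathcal T$ is merely a symbol), with $\operatorname{tr}^{\mathcal T}_F\colon\mathcal F(\mathcal T)\to\mathcal F(F)$ the natural projections. For $K\in\mathfrak T$, a local extension operator is a linear map $E^{\mathcal T}_K\colon\mathring{\mathcal F}(K)\to\mathcal F(\mathcal T)$ such that $\operatorname{tr}^{\mathcal T}_KE^{\mathcal T}_K\colon\mathring{\mathcal F}(K)\to\mathcal F(K)$ is the inclusion and $\operatorname{tr}^{\mathcal T}_FE^{\mathcal T}_K=0$ for all $F\in\mathfrak T$ with $K\not\le F$. The condition on $\mathring{\mathcal F}(F)^\dagger\subseteq\mathcal F(F)^*$ means explicitly: for every $\alpha\in\mathring{\mathcal F}(F)^*$ there exists $\beta\in\mathring{\mathcal F}(F)^\dagger$ with $\beta(\phi)=\alpha(\phi)$ for all $\phi\in\mathring{\mathcal F}(F)$; and if $\beta\in\mathring{\mathcal F}(F)^\dagger$ satisfies $\beta(\phi)=0$ for all $\phi\in\mathring{\mathcal F}(F)$, then $\beta=0$. *)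

theory Defs
  imports "Jordan_Normal_Form.Missing_VectorSpace"
begin

section \<open>Dual spaces\<close>

definition scalar_space :: "('k, 'm) ring_scheme \<Rightarrow> ('k, 'k) module" where
  "scalar_space K = \<lparr>carrier = carrier K, monoid.mult = monoid.mult K, one = one K,
     zero = zero K, add = add K, smult = monoid.mult K\<rparr>"

text \<open>Functionals are extensional, i.e. \<open>undefined\<close> off \<open>carrier V\<close>, so that equality in the
  dual space is equality on \<open>carrier V\<close>. The operations are the pointwise ones of
  \<open>func_space\<close>.\<close>

definition dual_space ::
  "('k, 'm) ring_scheme \<Rightarrow> ('k, 'v, 'n) module_scheme \<Rightarrow> ('k, 'v \<Rightarrow> 'k) module" where
  "dual_space K V = (ring.func_space K (carrier V))
     \<lparr>carrier := {\<alpha> \<in> extensional (carrier V). linear_map K V (scalar_space K) \<alpha>}\<rparr>"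

text \<open>For a linear map \<open>A\<close> from \<open>V\<close> to \<open>W\<close>, the map \<open>\<alpha> \<mapsto> \<alpha> \<circ> A\<close> into the dual of \<open>V\<close>.\<close>

definition dual_map ::
  "('k, 'v, 'n) module_scheme \<Rightarrow> ('v \<Rightarrow> 'w) \<Rightarrow> ('w \<Rightarrow> 'k) \<Rightarrow> ('v \<Rightarrow> 'k)" where
  "dual_map V A \<alpha> = compose (carrier V) \<alpha> A"

text \<open>\<open>D\<close> is a subspace of the dual of \<open>V\<close> which restriction of functionals to the subspace \<open>W\<close>
  of \<open>V\<close> maps isomorphically onto the dual of \<open>W\<close>; see \<open>restricts_isomorphically_iff\<close> below.\<close>

definition restricts_isomorphically ::
  "('k, 'm) ring_scheme \<Rightarrow> ('k, 'v, 'n) module_scheme \<Rightarrow> 'v set \<Rightarrow> ('v \<Rightarrow> 'k) set \<Rightarrow> bool" where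
  "restricts_isomorphically K V W D \<longleftrightarrow>
     subspace K D (dual_space K V) \<and>
     (\<forall>\<alpha>\<in>carrier (dual_space K (V\<lparr>carrier := W\<rparr>)). \<exists>\<beta>\<in>D. \<forall>\<phi>\<in>W. \<beta> \<phi> = \<alpha> \<phi>) \<and>
     (\<forall>\<beta>\<in>D. (\<forall>\<phi>\<in>W. \<beta> \<phi> = \<zero>\<^bsub>K\<^esub>) \<longrightarrow> \<beta> = \<zero>\<^bsub>dual_space K V\<^esub>)"

definition internal_direct_sum ::
  "('k, 'm) ring_scheme \<Rightarrow> ('k, 'v, 'n) module_scheme \<Rightarrow> 'i set \<Rightarrow> ('i \<Rightarrow> 'v set) \<Rightarrow> bool" where
  "internal_direct_sum K V I W \<longleftrightarrow>
     vectorspace K V \<and> finite I \<and> (\<forall>i\<in>I. subspace K (W i) V) \<and>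
     (\<forall>v\<in>carrier V. \<exists>!w. w \<in> (\<Pi>\<^sub>E i\<in>I. W i) \<and> v = (\<Oplus>\<^bsub>V\<^esub>i\<in>I. w i))"


section \<open>Function spaces on partially ordered sets\<close>

text \<open>\<open>tr F G\<close> is the trace map from \<open>V F\<close> to \<open>V G\<close>; it is relevant only for \<open>G \<le> F\<close>.\<close>

locale function_space =
  fixes K :: "('k, 'm) ring_scheme"
    and T :: "'t::order set"
    and V :: "'t \<Rightarrow> ('k, 'v, 'n) module_scheme"
    and tr :: "'t \<Rightarrow> 't \<Rightarrow> 'v \<Rightarrow> 'v"
  assumes field: "field K"
    and vectorspace: "F \<in> T \<Longrightarrow> vectorspace K (V F)"
    and linear: "F \<in> T \<Longrightarrow> G \<in> T \<Longrightarrow> G \<le> F \<Longrightarrow> linear_map K (V F) (V G) (tr F G)"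
    and tr_id: "F \<in> T \<Longrightarrow> \<phi> \<in> carrier (V F) \<Longrightarrow> tr F F \<phi> = \<phi>"
    and tr_tr: "F \<in> T \<Longrightarrow> G \<in> T \<Longrightarrow> H \<in> T \<Longrightarrow> H \<le> G \<Longrightarrow> G \<le> F \<Longrightarrow> \<phi> \<in> carrier (V F) \<Longrightarrow>
      tr G H (tr F G \<phi>) = tr F H \<phi>"

definition vanishing_trace ::
  "'t::order set \<Rightarrow> ('t \<Rightarrow> ('k, 'v, 'n) module_scheme) \<Rightarrow> ('t \<Rightarrow> 't \<Rightarrow> 'v \<Rightarrow> 'v) \<Rightarrow> 't \<Rightarrow> 'v set"
where
  "vanishing_trace T V tr F =
     {\<phi> \<in> carrier (V F). \<forall>G\<in>T. G < F \<longrightarrow> tr F G \<phi> = \<zero>\<^bsub>V G\<^esub>}"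

text \<open>The ring multiplication of the record plays no role; as in \<open>func_space\<close> it is constantly
  zero.\<close>

definition global_space ::
  "'t::order set \<Rightarrow> ('t \<Rightarrow> ('k, 'v, 'n) module_scheme) \<Rightarrow> ('t \<Rightarrow> 't \<Rightarrow> 'v \<Rightarrow> 'v) \<Rightarrow>
     ('k, 't \<Rightarrow> 'v) module"
where
  "global_space T V tr =
     \<lparr>carrier = {\<phi> \<in> (\<Pi>\<^sub>E F\<in>T. carrier (V F)). \<forall>F\<in>T. \<forall>G\<in>T. G \<le> F \<longrightarrow> tr F G (\<phi> F) = \<phi> G},
      monoid.mult = (\<lambda>\<phi> \<psi>. \<lambda>F\<in>T. \<zero>\<^bsub>V F\<^esub>),
      one = (\<lambda>F\<in>T. \<zero>\<^bsub>V F\<^esub>),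
      zero = (\<lambda>F\<in>T. \<zero>\<^bsub>V F\<^esub>),
      add = (\<lambda>\<phi> \<psi>. \<lambda>F\<in>T. \<phi> F \<oplus>\<^bsub>V F\<^esub> \<psi> F),
      smult = (\<lambda>c \<phi>. \<lambda>F\<in>T. c \<odot>\<^bsub>V F\<^esub> \<phi> F)\<rparr>"

definition global_trace :: "'t \<Rightarrow> ('t \<Rightarrow> 'v) \<Rightarrow> 'v" where
  "global_trace F \<phi> = \<phi> F"

definition local_extension_operator ::
  "('k, 'm) ring_scheme \<Rightarrow> 't::order set \<Rightarrow> ('t \<Rightarrow> ('k, 'v, 'n) module_scheme) \<Rightarrow>
     ('t \<Rightarrow> 't \<Rightarrow> 'v \<Rightarrow> 'v) \<Rightarrow> 't \<Rightarrow> ('v \<Rightarrow> 't \<Rightarrow> 'v) \<Rightarrow> bool"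
where
  "local_extension_operator K T V tr G E \<longleftrightarrow>
     linear_map K (V G\<lparr>carrier := vanishing_trace T V tr G\<rparr>) (global_space T V tr) E \<and>
     (\<forall>\<phi>\<in>vanishing_trace T V tr G. global_trace G (E \<phi>) = \<phi>) \<and>
     (\<forall>F\<in>T. \<not> G \<le> F \<longrightarrow>
        (\<forall>\<phi>\<in>vanishing_trace T V tr G. global_trace F (E \<phi>) = \<zero>\<^bsub>V F\<^esub>))"


section \<open>Basic facts\<close>

lemma scalar_space_vectorspace:
  assumes "field K"
  shows "vectorspace K (scalar_space K)"
proof -
  interpret field K by fact
  show ?thesis
    by (rule vs_criteria)
      (auto simp: scalar_space_def assms a_ac m_assoc l_distr r_distr
        intro!: bexI[of _ "\<ominus>\<^bsub>K\<^esub> _"] r_neg)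
qed

lemma dual_space_carrier_iff:
  assumes "vectorspace K V"
  shows "\<alpha> \<in> carrier (dual_space K V) \<longleftrightarrow>
    \<alpha> \<in> (carrier V \<rightarrow>\<^sub>E carrier K) \<and>
    (\<forall>v\<in>carrier V. \<forall>w\<in>carrier V. \<alpha> (v \<oplus>\<^bsub>V\<^esub> w) = \<alpha> v \<oplus>\<^bsub>K\<^esub> \<alpha> w) \<and>
    (\<forall>c\<in>carrier K. \<forall>v\<in>carrier V. \<alpha> (c \<odot>\<^bsub>V\<^esub> v) = c \<otimes>\<^bsub>K\<^esub> \<alpha> v)"
proof -
  interpret V: vectorspace K V by fact
  have S: "vectorspace K (scalar_space K)"
    by (rule scalar_space_vectorspace) (rule V.field_axioms)
  then interpret S: vectorspace K "scalar_space K" .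
  have "linear_map K V (scalar_space K) \<alpha> \<longleftrightarrow> \<alpha> \<in> module_hom K V (scalar_space K)"
    unfolding linear_map_def mod_hom_def mod_hom_axioms_def
    using assms S V.module_axioms S.module_axioms by blast
  then show ?thesis
    by (auto simp: dual_space_def module_hom_def scalar_space_def PiE_def)
qed

lemma dual_space_vectorspace:
  assumes "vectorspace K V"
  shows "vectorspace K (dual_space K V)"
proof -
  interpret V: vectorspace K V by fact
  interpret F: vectorspace K "V.func_space (carrier V)" by (rule V.func_space_is_vs)
  have "subspace K (carrier (dual_space K V)) (V.func_space (carrier V))"
  proof (rule subspace.intro[OF F.vectorspace_axioms], unfold_locales, goal_cases)
    case 1
    show ?case
      by (auto simp: dual_space_carrier_iff[OF assms] V.func_space_def)
  next
    case (2 v w)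
    then show ?case
      by (auto simp: dual_space_carrier_iff[OF assms] V.func_space_def PiE_def Pi_def
          V.R.a_ac V.R.r_distr)
  next
    case 3
    show ?case
      by (auto simp: dual_space_carrier_iff[OF assms] V.func_space_def)
  next
    case (4 c v)
    then show ?case
      by (auto simp: dual_space_carrier_iff[OF assms] V.func_space_def PiE_def Pi_def
          V.R.m_ac V.R.r_distr)
  qed
  then have "vectorspace K (F.vs (carrier (dual_space K V)))"
    by (rule F.subspace_is_vs)
  then show ?thesis
    by (simp add: dual_space_def)
qed

lemma restricts_isomorphically_iff:
  assumes "vectorspace K V" and "subspace K W V"
  shows "restricts_isomorphically K V W D \<longleftrightarrow>
    subspace K D (dual_space K V) \<and>
    bij_betw (\<lambda>\<beta>. restrict \<beta> W) D (carrier (dual_space K (V\<lparr>carrier := W\<rparr>)))"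
proof (cases "subspace K D (dual_space K V)")
  case False
  then show ?thesis by (simp add: restricts_isomorphically_def)
next
  case D: True
  interpret V: vectorspace K V by fact
  have W: "vectorspace K (V\<lparr>carrier := W\<rparr>)"
    by (rule V.subspace_is_vs) fact
  interpret D: submodule K D "dual_space K V"
    using D by (simp add: subspace_def)
  interpret dual: vectorspace K "dual_space K V"
    by (rule dual_space_vectorspace) fact
  have WV: "W \<subseteq> carrier V"
    using assms(2) by (simp add: subspace_def submodule_def)
  have smult_D: "(\<ominus>\<^bsub>K\<^esub> \<one>\<^bsub>K\<^esub>) \<odot>\<^bsub>dual_space K V\<^esub> \<beta> \<in> D" if "\<beta> \<in> D" for \<beta>
    using that by (intro D.smult_closed) auto
  have D_PiE: "\<beta> \<in> (carrier V \<rightarrow>\<^sub>E carrier K)" if "\<beta> \<in> D" for \<beta>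
    using that D.subset dual_space_carrier_iff[OF assms(1), of \<beta>] by (simp add: subset_iff)
  have restr: "restrict \<beta> W \<in> carrier (dual_space K (V\<lparr>carrier := W\<rparr>))" if "\<beta> \<in> D" for \<beta>
  proof -
    have "\<beta> \<in> carrier (dual_space K V)" using that D.subset by blast
    note \<beta> = this[unfolded dual_space_carrier_iff[OF assms(1)]]
    have W_closed: "\<And>v w. v \<in> W \<Longrightarrow> w \<in> W \<Longrightarrow> v \<oplus>\<^bsub>V\<^esub> w \<in> W"
      "\<And>c v. c \<in> carrier K \<Longrightarrow> v \<in> W \<Longrightarrow> c \<odot>\<^bsub>V\<^esub> v \<in> W"
      using assms(2) by (simp_all add: subspace_def submodule_def)
    show ?thesis
      unfolding dual_space_carrier_iff[OF W]
      using \<beta> WV W_closed by (auto simp: PiE_iff subset_iff)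
  qed
  have zero_D: "\<zero>\<^bsub>dual_space K V\<^esub> = (\<lambda>v\<in>carrier V. \<zero>\<^bsub>K\<^esub>)"
    by (simp add: dual_space_def V.func_space_def)
  have inj: "inj_on (\<lambda>\<beta>. restrict \<beta> W) D \<longleftrightarrow>
    (\<forall>\<beta>\<in>D. (\<forall>\<phi>\<in>W. \<beta> \<phi> = \<zero>\<^bsub>K\<^esub>) \<longrightarrow> \<beta> = \<zero>\<^bsub>dual_space K V\<^esub>)" (is "?l \<longleftrightarrow> ?r")
  proof
    assume ?l
    show ?r
    proof (intro ballI impI)
      fix \<beta> assume \<beta>: "\<beta> \<in> D" "\<forall>\<phi>\<in>W. \<beta> \<phi> = \<zero>\<^bsub>K\<^esub>"
      have "restrict \<beta> W = restrict \<zero>\<^bsub>dual_space K V\<^esub> W"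
        using \<beta>(2) WV by (intro restrict_ext) (auto simp: zero_D)
      then show "\<beta> = \<zero>\<^bsub>dual_space K V\<^esub>"
        using \<open>?l\<close> \<beta>(1) D.zero_closed by (auto dest: inj_onD)
    qed
  next
    assume r: ?r
    show ?l
    proof (rule inj_onI)
      fix \<beta> \<gamma> assume *: "\<beta> \<in> D" "\<gamma> \<in> D" "restrict \<beta> W = restrict \<gamma> W"
      define \<delta> where "\<delta> = \<beta> \<oplus>\<^bsub>dual_space K V\<^esub> ((\<ominus>\<^bsub>K\<^esub> \<one>\<^bsub>K\<^esub>) \<odot>\<^bsub>dual_space K V\<^esub> \<gamma>)"
      have \<delta>: "\<delta> v = \<beta> v \<ominus>\<^bsub>K\<^esub> \<gamma> v" if "v \<in> carrier V" for v
      proof -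
        have "\<gamma> v \<in> carrier K" using D_PiE[OF *(2)] that by auto
        then show ?thesis
          using that
          by (simp add: \<delta>_def dual_space_def V.func_space_def a_minus_def V.R.l_minus)
      qed
      have "\<delta> \<in> D"
        unfolding \<delta>_def using * smult_D by (intro D.m_closed)
      moreover have "\<forall>\<phi>\<in>W. \<delta> \<phi> = \<zero>\<^bsub>K\<^esub>"
      proof
        fix \<phi> assume "\<phi> \<in> W"
        then have "\<beta> \<phi> = \<gamma> \<phi>" using *(3) by (metis restrict_apply')
        moreover have "\<gamma> \<phi> \<in> carrier K" using D_PiE[OF *(2)] \<open>\<phi> \<in> W\<close> WV by auto
        ultimately show "\<delta> \<phi> = \<zero>\<^bsub>K\<^esub>"
          using \<delta> \<open>\<phi> \<in> W\<close> WV by (auto simp: a_minus_def V.R.r_neg)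
      qed
      ultimately have "\<delta> = (\<lambda>v\<in>carrier V. \<zero>\<^bsub>K\<^esub>)" using r zero_D by auto
      then have eq: "\<beta> v \<ominus>\<^bsub>K\<^esub> \<gamma> v = \<zero>\<^bsub>K\<^esub>" if "v \<in> carrier V" for v
        using \<delta>[OF that] that by simp
      show "\<beta> = \<gamma>"
      proof (rule PiE_ext[OF D_PiE[OF *(1)] D_PiE[OF *(2)]])
        fix v assume v: "v \<in> carrier V"
        have "\<beta> v \<in> carrier K" "\<gamma> v \<in> carrier K" using D_PiE * v by auto
        moreover from this have "\<beta> v = (\<beta> v \<ominus>\<^bsub>K\<^esub> \<gamma> v) \<oplus>\<^bsub>K\<^esub> \<gamma> v"
          by (simp add: a_minus_def V.R.a_assoc V.R.l_neg)
        ultimately show "\<beta> v = \<gamma> v" using eq[OF v] by simp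
      qed
    qed
  qed
  have ext: "\<alpha> = restrict \<beta> W \<longleftrightarrow> (\<forall>\<phi>\<in>W. \<beta> \<phi> = \<alpha> \<phi>)"
    if "\<alpha> \<in> carrier (dual_space K (V\<lparr>carrier := W\<rparr>))" for \<alpha> \<beta>
    using that unfolding dual_space_def
    by (auto intro!: extensionalityI[of _ W])
  have surj: "(\<lambda>\<beta>. restrict \<beta> W) ` D = carrier (dual_space K (V\<lparr>carrier := W\<rparr>)) \<longleftrightarrow>
    (\<forall>\<alpha>\<in>carrier (dual_space K (V\<lparr>carrier := W\<rparr>)). \<exists>\<beta>\<in>D. \<forall>\<phi>\<in>W. \<beta> \<phi> = \<alpha> \<phi>)"
    (is "?img = ?dual \<longleftrightarrow> ?r")
  proof
    assume eq: "?img = ?dual"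
    show ?r
    proof
      fix \<alpha> assume \<alpha>: "\<alpha> \<in> ?dual"
      then obtain \<beta> where "\<beta> \<in> D" "\<alpha> = restrict \<beta> W"
        using eq by (metis (no_types, lifting) imageE)
      then show "\<exists>\<beta>\<in>D. \<forall>\<phi>\<in>W. \<beta> \<phi> = \<alpha> \<phi>" by auto
    qed
  next
    assume r: ?r
    show "?img = ?dual"
    proof
      show "?img \<subseteq> ?dual" using restr by blast
      show "?dual \<subseteq> ?img"
      proof
        fix \<alpha> assume \<alpha>: "\<alpha> \<in> ?dual"
        then obtain \<beta> where "\<beta> \<in> D" "\<forall>\<phi>\<in>W. \<beta> \<phi> = \<alpha> \<phi>" using r by meson
        then show "\<alpha> \<in> ?img" using ext[OF \<alpha>] by (simp add: image_iff) metis
      qed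
    qed
  qed
  show ?thesis
    unfolding restricts_isomorphically_def bij_betw_def inj surj
    by (simp only: conj_ac)
qed

context function_space
begin

lemma vanishing_trace_subspace:
  assumes F: "F \<in> T"
  shows "subspace K (vanishing_trace T V tr F) (V F)"
proof -
  interpret F: vectorspace K "V F" by (rule vectorspace) fact
  have lin: "linear_map K (V F) (V G) (tr F G)" if "G \<in> T" "G < F" for G
    using that F by (intro linear) auto
  show ?thesis
  proof (rule subspace.intro[OF F.vectorspace_axioms], unfold_locales, goal_cases)
    case 1
    show ?case by (auto simp: vanishing_trace_def)
  next
    case (2 v w)
    show ?case
      unfolding vanishing_trace_def
    proof (safe, goal_cases)
      case 1
      then show ?case using 2 by (simp add: vanishing_trace_def)
    next
      case (2 G)
      interpret linear_map K "V F" "V G" "tr F G" using lin 2 by blast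
      show ?case using 2 \<open>v \<in> _\<close> \<open>w \<in> _\<close> by (simp add: vanishing_trace_def)
    qed
  next
    case 3
    show ?case
      unfolding vanishing_trace_def
    proof (safe, goal_cases)
      case (2 G)
      interpret linear_map K "V F" "V G" "tr F G" using lin 2 by blast
      show ?case by simp
    qed simp
  next
    case (4 c v)
    show ?case
      unfolding vanishing_trace_def
    proof (safe, goal_cases)
      case 1
      then show ?case using 4 by (simp add: vanishing_trace_def)
    next
      case (2 G)
      interpret linear_map K "V F" "V G" "tr F G" using lin 2 by blast
      show ?case using 2 \<open>c \<in> _\<close> \<open>v \<in> _\<close> by (simp add: vanishing_trace_def)
    qed
  qed
qed

lemma global_space_vectorspace: "vectorspace K (global_space T V tr)"
proof -
  have vs: "module K (V F)" if "F \<in> T" for F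
    using vectorspace[OF that] by (simp add: vectorspace_def)
  have ag: "abelian_group (V F)" if "F \<in> T" for F
    using vs[OF that] by (simp add: module_def)
  have hom: "tr F G \<in> module_hom K (V F) (V G)" if "F \<in> T" "G \<in> T" "G \<le> F" for F G
    using linear[OF that] by (simp add: linear_map_def mod_hom_def mod_hom_axioms_def)
  have hom_zero: "tr F G \<zero>\<^bsub>V F\<^esub> = \<zero>\<^bsub>V G\<^esub>" if "F \<in> T" "G \<in> T" "G \<le> F" for F G
    using linear_map.T0_is_0[OF linear[OF that]] .
  have am: "abelian_monoid (V F)" if "F \<in> T" for F
    using ag[OF that] by (simp add: abelian_group_def)
  note D = module_hom_add[OF hom] module_hom_smult[OF hom] hom_zero
  note M = abelian_monoid.a_comm[OF am]
    module.smult_l_distr[OF vs] module.smult_r_distr[OF vs]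
    module.smult_assoc1[OF vs] module.smult_one[OF vs]
  note [intro] = abelian_monoid.a_closed[OF am] module.smult_closed[OF vs]
    abelian_monoid.zero_closed[OF am] abelian_group.a_inv_closed[OF ag]
  interpret K: field K by (rule field)
  have neg: "tr F G ((\<ominus>\<^bsub>K\<^esub> \<one>\<^bsub>K\<^esub>) \<odot>\<^bsub>V F\<^esub> v) = (\<ominus>\<^bsub>K\<^esub> \<one>\<^bsub>K\<^esub>) \<odot>\<^bsub>V G\<^esub> tr F G v"
    if "F \<in> T" "G \<in> T" "G \<le> F" "v \<in> carrier (V F)" for F G v
    using that by (intro D) auto
  have neg': "v \<oplus>\<^bsub>V F\<^esub> ((\<ominus>\<^bsub>K\<^esub> \<one>\<^bsub>K\<^esub>) \<odot>\<^bsub>V F\<^esub> v) = \<zero>\<^bsub>V F\<^esub>" if "F \<in> T" "v \<in> carrier (V F)" for F v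
    using that module.smult_minus_1[OF vs] abelian_group.r_neg[OF ag] by simp
  show ?thesis
  proof (rule vs_criteria[OF field], goal_cases)
    case 3
    show ?case
    proof
      fix v assume "v \<in> carrier (global_space T V tr)"
      then show "\<exists>n\<in>carrier (global_space T V tr).
          v \<oplus>\<^bsub>global_space T V tr\<^esub> n = \<zero>\<^bsub>global_space T V tr\<^esub>"
        by (intro bexI[of _ "\<lambda>F\<in>T. (\<ominus>\<^bsub>K\<^esub> \<one>\<^bsub>K\<^esub>) \<odot>\<^bsub>V F\<^esub> v F"])
          (auto simp: global_space_def PiE_iff neg neg' intro!: restrict_ext)
    qed
  next
    case 6
    show ?case
      by (auto simp: global_space_def PiE_iff abelian_monoid.a_assoc[OF am] intro!: restrict_ext)
  next
    case 7
    show ?case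
      by (auto simp: global_space_def PiE_iff abelian_monoid.r_zero[OF am] intro!: extensionalityI[of _ T])
  qed (auto simp: global_space_def PiE_iff D M intro!: restrict_ext extensionalityI[of _ T])
qed

end

end

theory Submission
  imports Defs
begin

text \<open>
  Pairing functionals with extensions makes the problem triangular. For \<open>\<beta>\<close> in \<open>D G\<close> and
  \<open>\<phi>\<close> of vanishing trace on \<open>F\<close>, the pulled-back functional \<open>\<beta> \<circ> tr\<^sub>G\<close> takes the value
  \<open>\<beta> (tr\<^sub>G (E\<^sub>F \<phi>))\<close> on \<open>E\<^sub>F \<phi>\<close>. This is \<open>0\<close> unless \<open>F \<le> G\<close>, and for
  \<open>F = G\<close> it is just \<open>\<beta> \<phi>\<close>, so that the diagonal blocks are the restriction isomorphisms
  of the hypothesis. Triangularity with invertible diagonal gives existence and uniqueness of the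
  decomposition by elimination along the order, as far as functionals are tested on the
  functions \<open>E\<^sub>F \<phi>\<close>; and this is no restriction, because these functions span the global
  space (\<open>local_extensions_span\<close>).

  The elimination is linear algebra in a single vector space \<open>U\<close>, here the dual of the
  global space. It needs only the summands \<open>W F\<close>, here the pullbacks of \<open>D F\<close>, and the
  subspaces \<open>N F\<close> of those vectors that the \<open>F\<close>-th row of tests does not see, here the
  annihilators of the ranges of \<open>E\<^sub>F\<close>. An invertible diagonal block says that \<open>W F\<close> and
  \<open>N F\<close> are complementary, triangularity that \<open>W G\<close> lies in \<open>N F\<close> unless
  \<open>F \<le> G\<close>, and spanning that the \<open>N F\<close> meet in \<open>0\<close>
  (\<open>triangular_imp_internal_direct_sum\<close>).
\<close>


section \<open>Direct sums from triangular families of subspaces\<close>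

lemma (in subspace) mem_carrier: "v \<in> W \<Longrightarrow> v \<in> carrier V"
  using submodule.subset[OF submod] by blast

lemma (in subspace) diff_closed:
  assumes "v \<in> W" and "w \<in> W"
  shows "v \<ominus> w \<in> W"
proof -
  interpret vectorspace K V by (rule vs)
  interpret submodule K W V by (rule submod)
  have "(\<ominus>\<^bsub>K\<^esub> \<one>\<^bsub>K\<^esub>) \<odot> w \<in> W"
    using assms by (intro smult_closed) auto
  moreover have "w \<in> carrier V"
    using assms subset by blast
  ultimately show ?thesis
    using assms by (simp add: smult_minus_1 a_minus_def)
qed

lemma (in subspace) finsum_in_subspace:
  assumes "finite I" and "w \<in> I \<rightarrow> W"
  shows "(\<Oplus>i\<in>I. w i) \<in> W"
proof -
  interpret vectorspace K V by (rule vs)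
  interpret submodule K W V by (rule submod)
  show ?thesis
    using assms subset by (induction I rule: finite_induct) (auto simp: Pi_iff subset_iff)
qed

lemma (in vectorspace) finsum_diff:
  assumes "finite I" and "v \<in> I \<rightarrow> carrier V" and "w \<in> I \<rightarrow> carrier V"
  shows "(\<Oplus>\<^bsub>V\<^esub>i\<in>I. v i \<ominus>\<^bsub>V\<^esub> w i) = (\<Oplus>\<^bsub>V\<^esub>i\<in>I. v i) \<ominus>\<^bsub>V\<^esub> (\<Oplus>\<^bsub>V\<^esub>i\<in>I. w i)"
  using assms
proof (induction I rule: finite_induct)
  case empty
  show ?case by simp (metis M.l_zero M.minus_eq M.minus_equality M.zero_closed)
next
  case (insert i I)
  then show ?case
    by (simp add: Pi_iff M.minus_eq M.minus_add M.a_ac)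
qed

text \<open>At an index \<open>G\<close> that is maximal among those with \<open>w G \<noteq> 0\<close>, every other summand lies in
  \<open>N G\<close>: it vanishes if its index is above \<open>G\<close>, and triangularity applies otherwise. Hence
  \<open>w G\<close>, being minus the sum of the others, lies in \<open>N G\<close> as well.\<close>

lemma (in vectorspace) triangular_imp_independent:
  fixes T :: "'t::order set"
  assumes "finite T"
    and W: "\<And>F. F \<in> T \<Longrightarrow> subspace K (W F) V"
    and N: "\<And>F. F \<in> T \<Longrightarrow> subspace K (N F) V"
    and triangular: "\<And>F G. F \<in> T \<Longrightarrow> G \<in> T \<Longrightarrow> \<not> F \<le> G \<Longrightarrow> W G \<subseteq> N F"
    and disjoint: "\<And>F. F \<in> T \<Longrightarrow> W F \<inter> N F \<subseteq> {\<zero>\<^bsub>V\<^esub>}"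
    and w: "w \<in> (\<Pi> F\<in>T. W F)"
    and sum: "(\<Oplus>\<^bsub>V\<^esub>F\<in>T. w F) = \<zero>\<^bsub>V\<^esub>"
    and "F \<in> T"
  shows "w F = \<zero>\<^bsub>V\<^esub>"
proof (rule ccontr)
  assume "w F \<noteq> \<zero>\<^bsub>V\<^esub>"
  then obtain G where G: "G \<in> T" "w G \<noteq> \<zero>\<^bsub>V\<^esub>"
    and max: "\<And>H. H \<in> T \<Longrightarrow> w H \<noteq> \<zero>\<^bsub>V\<^esub> \<Longrightarrow> G \<le> H \<Longrightarrow> G = H"
    using finite_has_maximal[of "{F \<in> T. w F \<noteq> \<zero>\<^bsub>V\<^esub>}"] \<open>finite T\<close> \<open>F \<in> T\<close> by auto
  interpret N: subspace K "N G" V by (rule N) fact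
  interpret N: submodule K "N G" V by (rule N.submod)
  have w_closed: "w H \<in> carrier V" if "H \<in> T" for H
    using subspace.mem_carrier[OF W[OF that]] w that by blast
  have "w H \<in> N G" if "H \<in> T - {G}" for H
    using that max[of H] triangular[of G H] w G(1) N.zero_closed by (cases "w H = \<zero>\<^bsub>V\<^esub>") auto
  then have rest: "(\<Oplus>\<^bsub>V\<^esub>H\<in>T - {G}. w H) \<in> N G"
    using \<open>finite T\<close> by (intro N.finsum_in_subspace) auto
  have "(\<Oplus>\<^bsub>V\<^esub>H\<in>insert G (T - {G}). w H) = w G \<oplus>\<^bsub>V\<^esub> (\<Oplus>\<^bsub>V\<^esub>H\<in>T - {G}. w H)"
    using \<open>finite T\<close> w_closed G by (intro M.finsum_insert) auto
  then have "w G \<oplus>\<^bsub>V\<^esub> (\<Oplus>\<^bsub>V\<^esub>H\<in>T - {G}. w H) = \<zero>\<^bsub>V\<^esub>"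
    using G(1) sum by (simp add: insert_absorb)
  then have "w G = \<zero>\<^bsub>V\<^esub> \<ominus>\<^bsub>V\<^esub> (\<Oplus>\<^bsub>V\<^esub>H\<in>T - {G}. w H)"
    using w_closed[OF G(1)] rest N.subset
    by (metis M.add.inv_closed M.l_zero M.minus_equality M.minus_eq subsetD)
  then have "w G \<in> N G"
    using N.diff_closed[OF N.zero_closed rest] by simp
  then show False
    using disjoint[OF G(1)] w G by (auto simp: Pi_iff)
qed

text \<open>Back substitution: the components are chosen from the top of the order downwards. A
  component chosen at \<open>F\<close> corrects the error modulo \<open>N F\<close>, and it does not spoil what has
  been achieved at an index \<open>G\<close> treated before, because \<open>\<not> G \<le> F\<close> puts it into \<open>N G\<close>.\<close>

lemma (in vectorspace) triangular_imp_sum: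
  fixes T :: "'t::order set"
  assumes "finite T"
    and W: "\<And>F. F \<in> T \<Longrightarrow> subspace K (W F) V"
    and N: "\<And>F. F \<in> T \<Longrightarrow> subspace K (N F) V"
    and triangular: "\<And>F G. F \<in> T \<Longrightarrow> G \<in> T \<Longrightarrow> \<not> F \<le> G \<Longrightarrow> W G \<subseteq> N F"
    and cover: "\<And>F v. F \<in> T \<Longrightarrow> v \<in> carrier V \<Longrightarrow> \<exists>w\<in>W F. v \<ominus>\<^bsub>V\<^esub> w \<in> N F"
    and v: "v \<in> carrier V"
  shows "\<exists>w\<in>(\<Pi>\<^sub>E F\<in>T. W F). \<forall>F\<in>T. v \<ominus>\<^bsub>V\<^esub> (\<Oplus>\<^bsub>V\<^esub>G\<in>T. w G) \<in> N F"
  using \<open>finite T\<close>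
proof (induction T rule: finite_remove_induct)
  case empty
  show ?case by simp
next
  case (remove S)
  obtain F where F: "F \<in> S" and min: "\<And>G. G \<in> S \<Longrightarrow> G \<le> F \<Longrightarrow> F = G"
    using finite_has_minimal[OF remove.hyps(1,2)] by blast
  obtain w where w: "w \<in> (\<Pi>\<^sub>E G\<in>S - {F}. W G)"
    and w_N: "\<And>G. G \<in> S - {F} \<Longrightarrow> v \<ominus>\<^bsub>V\<^esub> (\<Oplus>\<^bsub>V\<^esub>H\<in>S - {F}. w H) \<in> N G"
    using remove.IH[OF F] by blast
  define s where "s = (\<Oplus>\<^bsub>V\<^esub>H\<in>S - {F}. w H)"
  have W_closed: "x \<in> carrier V" if "x \<in> W G" "G \<in> S" for x G
    using subspace.mem_carrier[OF W] that remove.hyps(3) by blast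
  have w_closed: "w G \<in> carrier V" if "G \<in> S - {F}" for G
    using W_closed w that by blast
  then have s: "s \<in> carrier V"
    unfolding s_def by (intro M.finsum_closed) auto
  obtain x where x: "x \<in> W F" "(v \<ominus>\<^bsub>V\<^esub> s) \<ominus>\<^bsub>V\<^esub> x \<in> N F"
    using cover[of F "v \<ominus>\<^bsub>V\<^esub> s"] F remove.hyps v s by auto
  have x_closed: "x \<in> carrier V"
    using W_closed[OF x(1) F] .
  define w' where "w' = w(F := x)"
  have "w' \<in> (\<Pi>\<^sub>E G\<in>S. W G)"
    using w x F by (auto simp: w'_def PiE_iff extensional_def)
  moreover have "\<forall>G\<in>S. v \<ominus>\<^bsub>V\<^esub> (\<Oplus>\<^bsub>V\<^esub>H\<in>S. w' H) \<in> N G"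
  proof
    fix G assume G: "G \<in> S"
    have "(\<Oplus>\<^bsub>V\<^esub>H\<in>insert F (S - {F}). w' H) = w' F \<oplus>\<^bsub>V\<^esub> (\<Oplus>\<^bsub>V\<^esub>H\<in>S - {F}. w' H)"
      using remove.hyps w_closed x_closed
      by (intro M.finsum_insert) (auto simp: w'_def)
    also have "(\<Oplus>\<^bsub>V\<^esub>H\<in>S - {F}. w' H) = s"
      unfolding s_def using w_closed by (intro M.finsum_cong') (auto simp: w'_def)
    finally have "(\<Oplus>\<^bsub>V\<^esub>H\<in>S. w' H) = x \<oplus>\<^bsub>V\<^esub> s"
      using F by (simp add: insert_absorb w'_def)
    then have eq: "v \<ominus>\<^bsub>V\<^esub> (\<Oplus>\<^bsub>V\<^esub>H\<in>S. w' H) = (v \<ominus>\<^bsub>V\<^esub> s) \<ominus>\<^bsub>V\<^esub> x"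
      using v s x_closed by (simp add: M.minus_eq M.minus_add M.a_ac)
    show "v \<ominus>\<^bsub>V\<^esub> (\<Oplus>\<^bsub>V\<^esub>H\<in>S. w' H) \<in> N G"
    proof (cases "G = F")
      case True
      then show ?thesis using eq x by simp
    next
      case False
      then have "x \<in> N G"
        using min[OF G] triangular[of G F] x G F remove.hyps by blast
      moreover have "v \<ominus>\<^bsub>V\<^esub> s \<in> N G"
        using w_N[of G] G False by (simp add: s_def)
      ultimately show ?thesis
        unfolding eq using subspace.diff_closed[OF N, of G] G remove.hyps(3) by blast
    qed
  qed
  ultimately show ?case by blast
qed

text \<open>This is the inversion of a block triangular matrix, with \<open>V / N F\<close> as the target of its
  \<open>F\<close>-th row; the assumption \<open>separating\<close> makes a vector with zero image in all
  of these targets vanish.\<close>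

theorem (in vectorspace) triangular_imp_internal_direct_sum:
  fixes T :: "'t::order set"
  assumes "finite T"
    and W: "\<And>F. F \<in> T \<Longrightarrow> subspace K (W F) V"
    and N: "\<And>F. F \<in> T \<Longrightarrow> subspace K (N F) V"
    and triangular: "\<And>F G. F \<in> T \<Longrightarrow> G \<in> T \<Longrightarrow> \<not> F \<le> G \<Longrightarrow> W G \<subseteq> N F"
    and disjoint: "\<And>F. F \<in> T \<Longrightarrow> W F \<inter> N F \<subseteq> {\<zero>\<^bsub>V\<^esub>}"
    and cover: "\<And>F v. F \<in> T \<Longrightarrow> v \<in> carrier V \<Longrightarrow> \<exists>w\<in>W F. v \<ominus>\<^bsub>V\<^esub> w \<in> N F"
    and separating: "\<And>v. v \<in> carrier V \<Longrightarrow> \<forall>F\<in>T. v \<in> N F \<Longrightarrow> v = \<zero>\<^bsub>V\<^esub>"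
  shows "internal_direct_sum K V T W"
  unfolding internal_direct_sum_def
proof (intro conjI ballI)
  fix v assume v: "v \<in> carrier V"
  have W_closed: "w \<in> T \<rightarrow> carrier V" if "w \<in> (\<Pi>\<^sub>E F\<in>T. W F)" for w
    using that subspace.mem_carrier[OF W] by blast
  have "\<exists>w\<in>(\<Pi>\<^sub>E F\<in>T. W F). \<forall>F\<in>T. v \<ominus>\<^bsub>V\<^esub> (\<Oplus>\<^bsub>V\<^esub>G\<in>T. w G) \<in> N F"
    by (rule triangular_imp_sum[OF \<open>finite T\<close> W N triangular cover v])
  then obtain w where w: "w \<in> (\<Pi>\<^sub>E F\<in>T. W F)"
    and w_N: "\<And>F. F \<in> T \<Longrightarrow> v \<ominus>\<^bsub>V\<^esub> (\<Oplus>\<^bsub>V\<^esub>G\<in>T. w G) \<in> N F"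
    by blast
  have s: "(\<Oplus>\<^bsub>V\<^esub>G\<in>T. w G) \<in> carrier V"
    using W_closed[OF w] by (rule M.finsum_closed)
  have "v \<ominus>\<^bsub>V\<^esub> (\<Oplus>\<^bsub>V\<^esub>G\<in>T. w G) = \<zero>\<^bsub>V\<^esub>"
    using w_N v s by (intro separating) auto
  then have v_eq: "v = (\<Oplus>\<^bsub>V\<^esub>G\<in>T. w G)"
    using v s by simp
  show "\<exists>!w. w \<in> (\<Pi>\<^sub>E F\<in>T. W F) \<and> v = (\<Oplus>\<^bsub>V\<^esub>F\<in>T. w F)"
  proof (rule ex1I)
    show "w \<in> (\<Pi>\<^sub>E F\<in>T. W F) \<and> v = (\<Oplus>\<^bsub>V\<^esub>F\<in>T. w F)"
      using w v_eq by simp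
  next
    fix w' assume w': "w' \<in> (\<Pi>\<^sub>E F\<in>T. W F) \<and> v = (\<Oplus>\<^bsub>V\<^esub>F\<in>T. w' F)"
    have "(\<Oplus>\<^bsub>V\<^esub>F\<in>T. w' F \<ominus>\<^bsub>V\<^esub> w F) = v \<ominus>\<^bsub>V\<^esub> v"
      using finsum_diff[OF \<open>finite T\<close> W_closed W_closed, of w' w] w w' v_eq by simp
    then have sum: "(\<Oplus>\<^bsub>V\<^esub>F\<in>T. w' F \<ominus>\<^bsub>V\<^esub> w F) = \<zero>\<^bsub>V\<^esub>"
      using v by (simp add: M.minus_eq M.r_neg)
    have diff: "(\<lambda>F. w' F \<ominus>\<^bsub>V\<^esub> w F) \<in> (\<Pi> F\<in>T. W F)"
      using w w' by (auto intro!: subspace.diff_closed[OF W])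
    have eq: "w' F \<ominus>\<^bsub>V\<^esub> w F = \<zero>\<^bsub>V\<^esub>" if "F \<in> T" for F
      by (rule triangular_imp_independent[OF \<open>finite T\<close> W N triangular disjoint diff sum that])
    show "w' = w"
    proof (rule PiE_ext)
      fix F assume "F \<in> T"
      then show "w' F = w F"
        using eq[of F] W_closed[of w] W_closed[of w'] w w' by (auto simp: Pi_iff)
    qed (use w w' in auto)
  qed
qed (use assms vectorspace_axioms in auto)


section \<open>Annihilators and dual maps\<close>

definition annihilator ::
  "('k, 'm) ring_scheme \<Rightarrow> ('k, 'v, 'n) module_scheme \<Rightarrow> 'v set \<Rightarrow> ('v \<Rightarrow> 'k) set" where
  "annihilator K V X = {\<alpha> \<in> carrier (dual_space K V). \<forall>x\<in>X. \<alpha> x = \<zero>\<^bsub>K\<^esub>}"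

context vectorspace
begin

lemma zero_dual: "\<zero>\<^bsub>dual_space K V\<^esub> = (\<lambda>v\<in>carrier V. \<zero>\<^bsub>K\<^esub>)"
  by (simp add: dual_space_def func_space_def)

lemma add_dual: "\<alpha> \<oplus>\<^bsub>dual_space K V\<^esub> \<beta> = (\<lambda>v\<in>carrier V. \<alpha> v \<oplus>\<^bsub>K\<^esub> \<beta> v)"
  by (simp add: dual_space_def func_space_def)

lemma smult_dual: "c \<odot>\<^bsub>dual_space K V\<^esub> \<alpha> = (\<lambda>v\<in>carrier V. c \<otimes>\<^bsub>K\<^esub> \<alpha> v)"
  by (simp add: dual_space_def func_space_def)

lemma dual_linear_map:
  assumes "\<alpha> \<in> carrier (dual_space K V)"
  shows "linear_map K V (scalar_space K) \<alpha>"
  using assms by (simp add: dual_space_def)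

lemma dual_closed:
  assumes "\<alpha> \<in> carrier (dual_space K V)" and "v \<in> carrier V"
  shows "\<alpha> v \<in> carrier K"
  using assms by (auto simp: dual_space_carrier_iff[OF vectorspace_axioms])

lemma dual_apply_zero:
  assumes "\<alpha> \<in> carrier (dual_space K V)"
  shows "\<alpha> \<zero>\<^bsub>V\<^esub> = \<zero>\<^bsub>K\<^esub>"
  using linear_map.T0_is_0[OF dual_linear_map[OF assms]] by (simp add: scalar_space_def)

lemma diff_dual_apply:
  assumes "\<alpha> \<in> carrier (dual_space K V)" and "\<beta> \<in> carrier (dual_space K V)" and "v \<in> carrier V"
  shows "(\<alpha> \<ominus>\<^bsub>dual_space K V\<^esub> \<beta>) v = \<alpha> v \<ominus>\<^bsub>K\<^esub> \<beta> v"
proof -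
  interpret dual: vectorspace K "dual_space K V"
    by (rule dual_space_vectorspace) (rule vectorspace_axioms)
  have "\<alpha> \<ominus>\<^bsub>dual_space K V\<^esub> \<beta>
      = \<alpha> \<oplus>\<^bsub>dual_space K V\<^esub> (\<ominus>\<^bsub>K\<^esub> \<one>\<^bsub>K\<^esub>) \<odot>\<^bsub>dual_space K V\<^esub> \<beta>"
    using assms by (simp add: dual.M.minus_eq dual.smult_minus_1)
  then show ?thesis
    using assms dual_closed by (simp add: add_dual smult_dual R.minus_eq R.l_minus)
qed

lemma annihilator_subspace:
  assumes "X \<subseteq> carrier V"
  shows "subspace K (annihilator K V X) (dual_space K V)"
proof -
  interpret dual: vectorspace K "dual_space K V"
    by (rule dual_space_vectorspace) (rule vectorspace_axioms)
  show ?thesis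
  proof (rule subspace.intro[OF dual.vectorspace_axioms], unfold_locales, goal_cases)
    case 1
    show ?case by (auto simp: annihilator_def)
  next
    case (2 \<alpha> \<beta>)
    then have "\<alpha> \<oplus>\<^bsub>dual_space K V\<^esub> \<beta> \<in> carrier (dual_space K V)"
      by (auto simp: annihilator_def)
    with 2 assms show ?case
      by (auto simp: annihilator_def add_dual subset_iff)
  next
    case 3
    have "\<zero>\<^bsub>dual_space K V\<^esub> \<in> carrier (dual_space K V)" by simp
    with assms show ?case
      by (auto simp: annihilator_def zero_dual subset_iff)
  next
    case (4 c \<alpha>)
    then have "c \<odot>\<^bsub>dual_space K V\<^esub> \<alpha> \<in> carrier (dual_space K V)"
      by (auto simp: annihilator_def)
    with 4 assms show ?case
      by (auto simp: annihilator_def smult_dual subset_iff)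
  qed
qed

lemma kernel_subspace:
  assumes "\<alpha> \<in> carrier (dual_space K V)"
  shows "subspace K {v \<in> carrier V. \<alpha> v = \<zero>\<^bsub>K\<^esub>} V"
proof -
  interpret \<alpha>: linear_map K V "scalar_space K" \<alpha>
    using assms by (rule dual_linear_map)
  show ?thesis
    using \<alpha>.kerT_is_subspace unfolding \<alpha>.ker_def by (simp add: scalar_space_def)
qed

end

context linear_map
begin

lemma dual_map_closed:
  assumes "\<alpha> \<in> carrier (dual_space K W)"
  shows "dual_map V T \<alpha> \<in> carrier (dual_space K V)"
  using assms f_im
  by (auto simp: dual_space_carrier_iff[OF V.vectorspace_axioms]
      dual_space_carrier_iff[OF W.vectorspace_axioms] dual_map_def compose_def)

lemma dual_map_subspace:
  assumes "subspace K D (dual_space K W)"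
  shows "subspace K (dual_map V T ` D) (dual_space K V)"
proof -
  interpret D: submodule K D "dual_space K W"
    using assms by (simp add: subspace_def)
  have dual: "vectorspace K (dual_space K V)"
    by (rule dual_space_vectorspace) (rule V.vectorspace_axioms)
  then interpret dual: vectorspace K "dual_space K V" .
  show ?thesis
  proof (rule subspace.intro[OF dual], unfold_locales, goal_cases)
    case 1
    show ?case using D.subset dual_map_closed by auto
  next
    case (2 v w)
    then obtain \<alpha> \<beta> where "\<alpha> \<in> D" "\<beta> \<in> D" "v = dual_map V T \<alpha>" "w = dual_map V T \<beta>"
      by auto
    then show ?case
      by (intro image_eqI[of _ _ "\<alpha> \<oplus>\<^bsub>dual_space K W\<^esub> \<beta>"])
        (auto simp: dual_map_def compose_def V.add_dual W.add_dual
            D.m_closed[unfolded W.add_dual] intro!: restrict_ext)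
  next
    case 3
    show ?case
      by (intro image_eqI[of _ _ "\<zero>\<^bsub>dual_space K W\<^esub>"])
        (auto simp: dual_map_def compose_def V.zero_dual W.zero_dual
            D.zero_closed[unfolded W.zero_dual] intro!: restrict_ext)
  next
    case (4 c v)
    then obtain \<alpha> where "\<alpha> \<in> D" "v = dual_map V T \<alpha>"
      by auto
    then show ?case
      using 4 by (intro image_eqI[of _ _ "c \<odot>\<^bsub>dual_space K W\<^esub> \<alpha>"])
        (auto simp: dual_map_def compose_def V.smult_dual W.smult_dual
            D.smult_closed[unfolded W.smult_dual] intro!: restrict_ext)
  qed
qed

end


section \<open>Local extensions span the global function space\<close>

context function_space
begin

lemma global_trace_linear:
  assumes "F \<in> T"
  shows "linear_map K (global_space T V tr) (V F) (global_trace F)"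
proof -
  interpret G: vectorspace K "global_space T V tr" by (rule global_space_vectorspace)
  interpret F: vectorspace K "V F" by (rule vectorspace) fact
  show ?thesis
    using assms by unfold_locales (auto simp: module_hom_def global_space_def global_trace_def)
qed

lemma local_extension_closed:
  assumes "local_extension_operator K T V tr F E" and "\<phi> \<in> vanishing_trace T V tr F"
  shows "E \<phi> \<in> carrier (global_space T V tr)"
proof -
  interpret linear_map K "V F\<lparr>carrier := vanishing_trace T V tr F\<rparr>" "global_space T V tr" E
    using assms by (simp add: local_extension_operator_def)
  show ?thesis using f_im assms by simp
qed

text \<open>A global function is reduced to zero by peeling off extensions from the bottom of its
  support. If \<open>F\<close> is minimal in the support, then the component at \<open>F\<close> has vanishing trace,
  since its traces are components below \<open>F\<close>. Subtracting its extension therefore makes sense and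
  kills the component at \<open>F\<close>; the other components that change have indices above \<open>F\<close>.\<close>

lemma local_extensions_span:
  assumes "finite T"
    and E: "\<And>F. F \<in> T \<Longrightarrow> local_extension_operator K T V tr F (E F)"
    and M: "subspace K M (global_space T V tr)"
    and E_M: "\<And>F. F \<in> T \<Longrightarrow> E F ` vanishing_trace T V tr F \<subseteq> M"
  shows "M = carrier (global_space T V tr)"
proof
  interpret G: vectorspace K "global_space T V tr" by (rule global_space_vectorspace)
  interpret M: submodule K M "global_space T V tr" using M by (simp add: subspace_def)
  show "M \<subseteq> carrier (global_space T V tr)" by (rule M.subset)
  (* The support is only bounded, by an upper set S: subtracting an extension from F can
     create new components above F, and these must again lie in S. *)
  have "\<psi> \<in> M"
    if "finite S" "S \<subseteq> T" "\<forall>F\<in>S. \<forall>G\<in>T. F \<le> G \<longrightarrow> G \<in> S"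
      "\<psi> \<in> carrier (global_space T V tr)" "\<forall>F\<in>T - S. global_trace F \<psi> = \<zero>\<^bsub>V F\<^esub>" for S \<psi>
    using that
  proof (induction S arbitrary: \<psi> rule: finite_remove_induct)
    case empty
    have "\<psi> = \<zero>\<^bsub>global_space T V tr\<^esub>"
      using empty
      by (auto simp: global_space_def global_trace_def PiE_iff intro!: extensionalityI[of _ T])
    then show ?case by simp
  next
    case (remove S)
    obtain F where F: "F \<in> S" and min: "\<And>G. G \<in> S \<Longrightarrow> G \<le> F \<Longrightarrow> F = G"
      using finite_has_minimal[OF remove.hyps(1,2)] by blast
    have "F \<in> T" using F remove.prems by auto
    note upper = \<open>\<forall>F\<in>S. \<forall>G\<in>T. F \<le> G \<longrightarrow> G \<in> S\<close>
    have "global_trace F \<psi> \<in> vanishing_trace T V tr F"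
      unfolding vanishing_trace_def
    proof (intro CollectI conjI ballI impI)
      show "global_trace F \<psi> \<in> carrier (V F)"
        using remove.prems \<open>F \<in> T\<close> by (auto simp: global_space_def global_trace_def)
      fix G assume G: "G \<in> T" "G < F"
      then have "tr F G (global_trace F \<psi>) = global_trace G \<psi>"
        using remove.prems \<open>F \<in> T\<close> by (auto simp: global_space_def global_trace_def)
      also have "\<dots> = \<zero>\<^bsub>V G\<^esub>"
        using min G remove.prems(4) by (metis DiffI less_le)
      finally show "tr F G (global_trace F \<psi>) = \<zero>\<^bsub>V G\<^esub>" .
    qed
    note vt = this
    define \<eta> where "\<eta> = E F (global_trace F \<psi>)"
    have \<eta>: "\<eta> \<in> carrier (global_space T V tr)"
      unfolding \<eta>_def by (rule local_extension_closed[OF E[OF \<open>F \<in> T\<close>] vt])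
    have \<eta>_trace: "global_trace F \<eta> = global_trace F \<psi>"
      "\<And>G. G \<in> T \<Longrightarrow> \<not> F \<le> G \<Longrightarrow> global_trace G \<eta> = \<zero>\<^bsub>V G\<^esub>"
      using E[OF \<open>F \<in> T\<close>] vt by (auto simp: local_extension_operator_def \<eta>_def)
    have "\<psi> \<ominus>\<^bsub>global_space T V tr\<^esub> \<eta> \<in> M"
    proof (rule remove.IH[OF F])
      show "S - {F} \<subseteq> T" using remove.prems by auto
      show "\<forall>H\<in>S - {F}. \<forall>G\<in>T. H \<le> G \<longrightarrow> G \<in> S - {F}"
        using upper min by blast
      show "\<psi> \<ominus>\<^bsub>global_space T V tr\<^esub> \<eta> \<in> carrier (global_space T V tr)"
        using remove.prems \<eta> by simp
      show "\<forall>G\<in>T - (S - {F}). global_trace G (\<psi> \<ominus>\<^bsub>global_space T V tr\<^esub> \<eta>) = \<zero>\<^bsub>V G\<^esub>"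
      proof
        fix G assume G: "G \<in> T - (S - {F})"
        then interpret VG: vectorspace K "V G"
          by (intro vectorspace) simp
        from G interpret tr: linear_map K "global_space T V tr" "V G" "global_trace G"
          by (intro global_trace_linear) simp
        have "global_trace G \<psi> = global_trace G \<eta>"
        proof (cases "G = F")
          case True
          then show ?thesis using \<eta>_trace by simp
        next
          case False
          then have "G \<notin> S" using G by simp
          then have "\<not> F \<le> G"
            using upper F G by blast
          then show ?thesis
            using \<eta>_trace(2)[of G] \<open>G \<notin> S\<close> G remove.prems(4) by simp
        qed
        then show "global_trace G (\<psi> \<ominus>\<^bsub>global_space T V tr\<^esub> \<eta>) = \<zero>\<^bsub>V G\<^esub>"
          using remove.prems(3) \<eta> by (simp add: VG.M.minus_eq VG.M.r_neg)
      qed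
    qed
    moreover have "\<eta> \<in> M"
      using E_M[OF \<open>F \<in> T\<close>] vt by (auto simp: \<eta>_def)
    ultimately have "(\<psi> \<ominus>\<^bsub>global_space T V tr\<^esub> \<eta>) \<oplus>\<^bsub>global_space T V tr\<^esub> \<eta> \<in> M"
      by simp
    then show "\<psi> \<in> M"
      using remove.prems \<eta> by (simp add: G.M.minus_eq G.M.a_assoc G.M.l_neg)
  qed
  from this[of T] show "carrier (global_space T V tr) \<subseteq> M" using \<open>finite T\<close> by auto
qed

end


section \<open>The geometric decomposition of the dual\<close>

theorem corollary2p23:
  fixes K :: "('k, 'm) ring_scheme"
    and T :: "'t::order set"
    and V :: "'t \<Rightarrow> ('k, 'v, 'n) module_scheme"
    and tr :: "'t \<Rightarrow> 't \<Rightarrow> 'v \<Rightarrow> 'v"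
    and D :: "'t \<Rightarrow> ('v \<Rightarrow> 'k) set"
    and E :: "'t \<Rightarrow> 'v \<Rightarrow> 't \<Rightarrow> 'v"
  assumes "finite T"
    and "function_space K T V tr"
    and "\<And>F. F \<in> T \<Longrightarrow> restricts_isomorphically K (V F) (vanishing_trace T V tr F) (D F)"
    and "\<And>F. F \<in> T \<Longrightarrow> local_extension_operator K T V tr F (E F)"
  shows "internal_direct_sum K (dual_space K (global_space T V tr)) T
    (\<lambda>F. dual_map (global_space T V tr) (global_trace F) ` D F)"
proof -
  interpret function_space K T V tr by fact
  define Glob where "Glob = global_space T V tr"
  define N where
    "N F = annihilator K Glob (E F ` vanishing_trace T V tr F)" for F
  have Glob: "vectorspace K Glob"
    unfolding Glob_def by (rule global_space_vectorspace)
  interpret Glob: vectorspace K Glob by (rule Glob)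
  interpret dual: vectorspace K "dual_space K Glob"
    by (rule dual_space_vectorspace) (rule Glob)
  have trace: "linear_map K Glob (V F) (global_trace F)" if "F \<in> T" for F
    unfolding Glob_def using that by (rule global_trace_linear)
  have D_sub: "subspace K (D F) (dual_space K (V F))" if "F \<in> T" for F
    using assms(3)[OF that] by (simp add: restricts_isomorphically_def)
  then have D_dual: "\<beta> \<in> carrier (dual_space K (V F))" if "\<beta> \<in> D F" "F \<in> T" for F \<beta>
    using that by (blast intro: subspace.mem_carrier)
  have E_Glob: "E F \<phi> \<in> carrier Glob" if "F \<in> T" "\<phi> \<in> vanishing_trace T V tr F" for F \<phi>
    unfolding Glob_def using assms(4) that by (intro local_extension_closed)
  have pullback: "dual_map Glob (global_trace G) \<beta> (E F \<phi>) = \<beta> (global_trace G (E F \<phi>))"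
    if "F \<in> T" "\<phi> \<in> vanishing_trace T V tr F" for F G \<phi> \<beta>
    using E_Glob[OF that] by (simp add: dual_map_def compose_def)
  have W_sub: "subspace K (dual_map Glob (global_trace F) ` D F) (dual_space K Glob)"
    if "F \<in> T" for F
    by (rule linear_map.dual_map_subspace[OF trace[OF that] D_sub[OF that]])
  then have W_closed: "\<alpha> \<in> carrier (dual_space K Glob)"
    if "\<alpha> \<in> dual_map Glob (global_trace F) ` D F" "F \<in> T" for F \<alpha>
    using that by (blast intro: subspace.mem_carrier)
  show ?thesis
    unfolding Glob_def[symmetric]
  proof (rule dual.triangular_imp_internal_direct_sum[where N = N])
    fix F assume F: "F \<in> T"
    show "subspace K (N F) (dual_space K Glob)"
      unfolding N_def using E_Glob[OF F] by (intro Glob.annihilator_subspace) auto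
  next
    fix F G assume FG: "F \<in> T" "G \<in> T" "\<not> F \<le> G"
    show "dual_map Glob (global_trace G) ` D G \<subseteq> N F"
    proof
      fix \<alpha> assume \<alpha>: "\<alpha> \<in> dual_map Glob (global_trace G) ` D G"
      then obtain \<beta> where \<beta>: "\<beta> \<in> D G" "\<alpha> = dual_map Glob (global_trace G) \<beta>" by auto
      have "\<alpha> (E F \<phi>) = \<zero>\<^bsub>K\<^esub>" if "\<phi> \<in> vanishing_trace T V tr F" for \<phi>
      proof -
        have "global_trace G (E F \<phi>) = \<zero>\<^bsub>V G\<^esub>"
          using assms(4)[OF FG(1)] FG that by (simp add: local_extension_operator_def)
        then show ?thesis
          using \<beta> pullback[OF FG(1) that] FG
            vectorspace.dual_apply_zero[OF vectorspace D_dual] by simp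
      qed
      then show "\<alpha> \<in> N F"
        using W_closed[OF \<alpha> FG(2)] by (auto simp: N_def annihilator_def)
    qed
  next
    (* The diagonal block: W F and N F are complementary because restriction from D F to the
       functions of vanishing trace is injective and surjective. *)
    fix F assume F: "F \<in> T"
    have trace_E: "global_trace F (E F \<phi>) = \<phi>" if "\<phi> \<in> vanishing_trace T V tr F" for \<phi>
      using assms(4)[OF F] that by (simp add: local_extension_operator_def)
    show "dual_map Glob (global_trace F) ` D F \<inter> N F \<subseteq> {\<zero>\<^bsub>dual_space K Glob\<^esub>}"
    proof safe
      fix \<beta> assume \<beta>: "\<beta> \<in> D F" "dual_map Glob (global_trace F) \<beta> \<in> N F"
      have "\<beta> \<phi> = \<zero>\<^bsub>K\<^esub>" if "\<phi> \<in> vanishing_trace T V tr F" for \<phi>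
        using \<beta>(2) pullback[OF F that, of F \<beta>] trace_E[OF that] that
        by (simp add: N_def annihilator_def)
      then have "\<beta> = \<zero>\<^bsub>dual_space K (V F)\<^esub>"
        using assms(3)[OF F] \<beta>(1) by (simp add: restricts_isomorphically_def)
      moreover have "global_trace F v \<in> carrier (V F)" if "v \<in> carrier Glob" for v
        using F that by (auto simp: Glob_def global_space_def global_trace_def)
      ultimately show "dual_map Glob (global_trace F) \<beta> = \<zero>\<^bsub>dual_space K Glob\<^esub>"
        by (auto simp: dual_map_def compose_def Glob.zero_dual
            vectorspace.zero_dual[OF vectorspace[OF F]] intro!: restrict_ext)
    qed
    fix \<alpha> assume \<alpha>: "\<alpha> \<in> carrier (dual_space K Glob)"
    define V0 where "V0 = V F\<lparr>carrier := vanishing_trace T V tr F\<rparr>"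
    interpret E: linear_map K V0 Glob "E F"
      using assms(4)[OF F] by (simp add: local_extension_operator_def V0_def Glob_def)
    have V0_carrier: "carrier V0 = vanishing_trace T V tr F"
      by (simp add: V0_def)
    obtain \<beta> where \<beta>: "\<beta> \<in> D F"
      "\<And>\<phi>. \<phi> \<in> vanishing_trace T V tr F \<Longrightarrow> \<beta> \<phi> = dual_map V0 (E F) \<alpha> \<phi>"
      using assms(3)[OF F] E.dual_map_closed[OF \<alpha>]
      unfolding restricts_isomorphically_def V0_def by meson
    define \<gamma> where "\<gamma> = dual_map Glob (global_trace F) \<beta>"
    have \<gamma>: "\<gamma> \<in> dual_map Glob (global_trace F) ` D F"
      using \<beta>(1) by (simp add: \<gamma>_def)
    have "(\<alpha> \<ominus>\<^bsub>dual_space K Glob\<^esub> \<gamma>) (E F \<phi>) = \<zero>\<^bsub>K\<^esub>"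
      if "\<phi> \<in> vanishing_trace T V tr F" for \<phi>
    proof -
      have "\<gamma> (E F \<phi>) = \<alpha> (E F \<phi>)"
        using \<beta>(2)[OF that] pullback[OF F that] trace_E[OF that] that
        by (simp add: \<gamma>_def dual_map_def[of V0] compose_def V0_carrier)
      then show ?thesis
        using Glob.diff_dual_apply[OF \<alpha> W_closed[OF \<gamma> F] E_Glob[OF F that]]
          Glob.dual_closed[OF \<alpha> E_Glob[OF F that]]
        by (simp add: Glob.R.minus_eq Glob.R.r_neg)
    qed
    then have "\<alpha> \<ominus>\<^bsub>dual_space K Glob\<^esub> \<gamma> \<in> N F"
      using \<alpha> W_closed[OF \<gamma> F] by (auto simp: N_def annihilator_def)
    then show "\<exists>\<gamma>\<in>dual_map Glob (global_trace F) ` D F. \<alpha> \<ominus>\<^bsub>dual_space K Glob\<^esub> \<gamma> \<in> N F"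
      using \<gamma> by blast
  next
    fix \<alpha> assume \<alpha>: "\<alpha> \<in> carrier (dual_space K Glob)" and "\<forall>F\<in>T. \<alpha> \<in> N F"
    then have "E F ` vanishing_trace T V tr F \<subseteq> {v \<in> carrier Glob. \<alpha> v = \<zero>\<^bsub>K\<^esub>}"
      if "F \<in> T" for F
      using that E_Glob by (auto simp: N_def annihilator_def)
    then have "{v \<in> carrier Glob. \<alpha> v = \<zero>\<^bsub>K\<^esub>} = carrier Glob"
      using Glob.kernel_subspace[OF \<alpha>] assms(1,4) unfolding Glob_def
      by (intro local_extensions_span)
    then show "\<alpha> = \<zero>\<^bsub>dual_space K Glob\<^esub>"
      using \<alpha> unfolding Glob.zero_dual
      by (auto simp: dual_space_def intro!: extensionalityI[of _ "carrier Glob"])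
  qed (use assms(1) W_sub in auto)
qed

end
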